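(* Let $X$ be a non-negative absolutely continuous random variable with finite second moment which is DFR (decreasing failure rate). Then the cumulative entropy of $X$ satisfies $$\mathcal{CE}(X)\geq \mathbb{E}(X)-\frac{\sqrt{\mathbb{E}(X^2)}}{\sqrt{2}}\left(2-\frac{\pi^2}{6}\right).$$
   Context: $\log$ is the natural logarithm, with the convention $0\log 0=0$. The cumulative entropy of a non-negative absolutely continuous random variable $X$ with cumulative distribution function $F$ is $\mathcal{CE}(X)=-\int_0^{+\infty}F(x)\log F(x)\,dx$. A non-negative absolutely continuous random variable $X$ with cumulative distribution function $F$ and probability density function $f$ is DFR (decreasing failure rate) if its failure rate $x\mapsto f(x)/(1-F(x))$ is (for a suitable version of $f$) non-increasing on $(0,+\infty)$. *)

theory Defs
  imports "HOL-Probability.Probability"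
begin

(* At F x = 0 the integrand is 0 * ln 0 = 0, as in the usual convention.
   Since 0 <= - u * ln u <= 1 - u on [0,1], the integrand is integrable whenever X is
   non-negative with finite mean, so the default value 0 of the Bochner integral
   is never met in that case. *)
definition cumulative_entropy :: "'a measure \<Rightarrow> ('a \<Rightarrow> real) \<Rightarrow> real" where
  "cumulative_entropy M X =
    - (LINT x:{0..}|lborel. cdf (distr M borel X) x * ln (cdf (distr M borel X) x))"

definition failure_rate :: "'a measure \<Rightarrow> ('a \<Rightarrow> real) \<Rightarrow> (real \<Rightarrow> real) \<Rightarrow> real \<Rightarrow> real" where
  "failure_rate M X f x = f x / (1 - cdf (distr M borel X) x)"

(* The density f is determined only up to null sets, hence the existential quantifier.
   For non-negative X division by 0 does not matter: the cumulative hazard - ln (1 - F) tends to infinity at a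
   finite right end point b > 0 of the support, whereas a non-increasing failure rate is
   bounded on [c,b) for 0 < c < b.  So the monotonicity forces F x < 1 for every x. *)
definition DFR :: "'a measure \<Rightarrow> ('a \<Rightarrow> real) \<Rightarrow> bool" where
  "DFR M X \<longleftrightarrow>
    (\<exists>f. (\<forall>x. 0 \<le> f x) \<and> distributed M lborel X (\<lambda>x. ennreal (f x)) \<and>
         antimono_on {0<..} (failure_rate M X f))"

end

theory Submission
  imports Defs "HOL-Real_Asymp.Real_Asymp"
begin

text \<open>
  Let \<open>S = 1 - F\<close> be the survival function of \<open>X\<close> and \<open>h s = s + (1 - s) * ln (1 - s)\<close>. Since the
  mean of \<open>X\<close> is the integral of \<open>S\<close> over the positive half-line, the cumulative entropy equals the
  mean minus the integral of \<open>h (S x)\<close>. The second moment of \<open>X\<close> is twice the integral of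
  \<open>x * S x\<close>. The claim is therefore that, among all DFR survival functions with a given value \<open>A\<^sup>2\<close>
  of the integral of \<open>x * S x\<close>, the integral of \<open>h (S x)\<close> is largest for the exponential
  distribution \<open>exp (- x / A)\<close>, for which expanding \<open>h\<close> into a power series and using the Basel
  series gives the value \<open>A * (2 - pi\<^sup>2 / 6)\<close>.

  The extremality is a single-crossing argument
  (\<open>entropy_deficit_integral_le_exponential\<close>). A decreasing failure rate makes \<open>- ln S\<close> concave,
  hence \<open>- ln (S x) / x\<close> non-increasing (\<open>DFR_survival_positive_and_star_shaped\<close>), so \<open>S\<close> lies
  below the exponential up to a crossing point \<open>z\<close> and above it afterwards. As \<open>h\<close> is convex
  with derivative \<open>- ln (1 - s)\<close>, the difference of the integrands is at most
  \<open>(- ln (1 - S x) / x) * (x * (S x - exp (- x / A)))\<close>. The first factor is non-increasing and the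
  second changes sign once, from negative to positive, and has integral zero; hence the integral
  of the product is not positive.
\<close>

section \<open>Moments as integrals of the survival function\<close>

text \<open>
  Writing \<open>X ^ Suc k\<close> as the integral of \<open>Suc k * x ^ k\<close> over \<open>0 \<le> x < X\<close> and exchanging the
  order of integration (Tonelli) turns a moment into an integral of the survival function. The
  cases \<open>k = 0\<close> and \<open>k = 1\<close> express the mean and the second moment.
\<close>

lemma (in prob_space) moment_eq_tail_integral:
  fixes X :: "'a \<Rightarrow> real"
  assumes [measurable]: "X \<in> borel_measurable M"
    and nonneg: "AE \<omega> in M. 0 \<le> X \<omega>"
    and int: "integrable M (\<lambda>\<omega>. X \<omega> ^ Suc k)"
  defines "S \<equiv> \<lambda>x. 1 - cdf (distr M borel X) x"
  shows "set_integrable lborel {0..} (\<lambda>x. Suc k * x ^ k * S x)"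
    and "(LINT x:{0..}|lborel. Suc k * x ^ k * S x) = expectation (\<lambda>\<omega>. X \<omega> ^ Suc k)"
proof -
  interpret D: real_distribution "distr M borel X" by simp
  have meas_cdf [measurable]: "cdf (distr M borel X) \<in> borel_measurable borel"
    by (intro borel_measurable_mono monoI D.cdf_nondecreasing)
  have tail: "ennreal (S x) = emeasure M {\<omega>\<in>space M. x < X \<omega>}" for x
  proof -
    have "cdf (distr M borel X) x = prob {\<omega>\<in>space M. X \<omega> \<le> x}"
      by (simp add: cdf_def2 measure_distr vimage_def Int_def conj_commute)
    moreover have "prob {\<omega>\<in>space M. \<not> X \<omega> \<le> x} = 1 - prob {\<omega>\<in>space M. X \<omega> \<le> x}"
      by (rule prob_neg) simp
    ultimately show ?thesis by (simp add: S_def emeasure_eq_measure not_le)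
  qed
  have S0: "0 \<le> S x" for x using D.cdf_bounded_prob[of x] by (simp add: S_def)
  have E0: "0 \<le> expectation (\<lambda>\<omega>. X \<omega> ^ Suc k)"
    using nonneg by (intro integral_nonneg_AE) (auto elim!: eventually_mono)
  have power_layers: "ennreal (y ^ Suc k) =
      (\<integral>\<^sup>+x. ennreal (Suc k * x ^ k) * indicator {0..} x * indicator {..<y} x \<partial>lborel)"
    if "0 \<le> y" for y :: real
  proof -
    have "(\<integral>\<^sup>+x. ennreal (Suc k * x ^ k) * indicator {0..} x * indicator {..<y} x \<partial>lborel)
        = (\<integral>\<^sup>+x. ennreal (Suc k * x ^ k) * indicator {0..y} x \<partial>lborel)"
      using AE_lborel_singleton[of y]
      by (intro nn_integral_cong_AE) (auto elim!: eventually_mono split: split_indicator)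
    also have "\<dots> = ennreal (y ^ Suc k - 0 ^ Suc k)"
      by (rule nn_integral_FTC_Icc)
        (use that DERIV_pow[of "Suc k"] in \<open>auto simp del: power_Suc of_nat_Suc\<close>)
    finally show ?thesis by simp
  qed
  have "ennreal (expectation (\<lambda>\<omega>. X \<omega> ^ Suc k)) = (\<integral>\<^sup>+\<omega>. ennreal (X \<omega> ^ Suc k) \<partial>M)"
    using int nonneg by (intro nn_integral_eq_integral[symmetric]) (auto elim!: eventually_mono)
  also have "\<dots> = (\<integral>\<^sup>+\<omega>. (\<integral>\<^sup>+x. ennreal (Suc k * x ^ k) * indicator {0..} x
      * indicator {x<..} (X \<omega>) \<partial>lborel) \<partial>M)"
    using nonneg by (intro nn_integral_cong_AE)
      (auto elim!: eventually_mono simp: power_layers simp del: power_Suc of_nat_Suc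
        intro!: nn_integral_cong split: split_indicator)
  also have "\<dots> = (\<integral>\<^sup>+x. (\<integral>\<^sup>+\<omega>. ennreal (Suc k * x ^ k) * indicator {0..} x
      * indicator {x<..} (X \<omega>) \<partial>M) \<partial>lborel)"
  proof -
    interpret P: pair_sigma_finite lborel M by unfold_locales
    have [measurable]: "Measurable.pred (lborel \<Otimes>\<^sub>M M) (\<lambda>z. X (snd z) \<in> {fst z<..})"
      by (simp add: greaterThan_def)
    show ?thesis by (rule P.Fubini') (simp add: case_prod_beta)
  qed
  also have "\<dots> = (\<integral>\<^sup>+x. ennreal (indicator {0..} x * (Suc k * x ^ k * S x)) \<partial>lborel)"
  proof (intro nn_integral_cong)
    fix x :: real
    have "(\<integral>\<^sup>+\<omega>. ennreal (Suc k * x ^ k) * indicator {0..} x * indicator {x<..} (X \<omega>) \<partial>M)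
        = ennreal (Suc k * x ^ k) * indicator {0..} x
          * (\<integral>\<^sup>+\<omega>. indicator {\<omega>\<in>space M. x < X \<omega>} \<omega> \<partial>M)"
      by (subst nn_integral_cmult[symmetric])
        (auto intro!: nn_integral_cong split: split_indicator)
    then show "(\<integral>\<^sup>+\<omega>. ennreal (Suc k * x ^ k) * indicator {0..} x * indicator {x<..} (X \<omega>) \<partial>M)
        = ennreal (indicator {0..} x * (Suc k * x ^ k * S x))"
      using S0[of x] by (simp add: tail[symmetric] ennreal_mult split: split_indicator)
  qed
  finally have *: "(\<integral>\<^sup>+x. ennreal (indicator {0..} x * (Suc k * x ^ k * S x)) \<partial>lborel)
      = ennreal (expectation (\<lambda>\<omega>. X \<omega> ^ Suc k))" ..
  have "(\<lambda>x. indicator {0..} x * (Suc k * x ^ k * S x)) \<in> borel_measurable lborel"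
    unfolding S_def by measurable
  moreover have "AE x in lborel. 0 \<le> indicator {0..} x * (Suc k * x ^ k * S x)"
    using S0 by (auto split: split_indicator)
  ultimately have "integrable lborel (\<lambda>x. indicator {0..} x * (Suc k * x ^ k * S x))
      \<and> (LINT x|lborel. indicator {0..} x * (Suc k * x ^ k * S x))
        = expectation (\<lambda>\<omega>. X \<omega> ^ Suc k)"
    using nn_integral_eq_integrable[OF _ _ E0] * by blast
  then show "set_integrable lborel {0..} (\<lambda>x. Suc k * x ^ k * S x)"
    and "(LINT x:{0..}|lborel. Suc k * x ^ k * S x) = expectation (\<lambda>\<omega>. X \<omega> ^ Suc k)"
    by (auto simp: set_integrable_def set_lebesgue_integral_def)
qed

section \<open>Survival functions with decreasing failure rate\<close>

text \<open>
  A Gronwall inequality that asks neither for derivatives nor for continuity: subdivide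
  \<open>[a, b]\<close> into \<open>n\<close> equal parts, multiply the one-step bounds, and let \<open>n\<close> tend to infinity in
  \<open>(1 - c * (b - a) / n) ^ n\<close>. The sign of \<open>c\<close> is arbitrary, so that it also serves, after
  the reflection \<open>x \<mapsto> - x\<close>, for bounds in the opposite direction.
\<close>

lemma exp_le_of_relative_increments:
  fixes S :: "real \<Rightarrow> real"
  assumes "a \<le> b"
    and step: "\<And>x y. a \<le> x \<Longrightarrow> x \<le> y \<Longrightarrow> y \<le> b \<Longrightarrow> S x * (1 - c * (y - x)) \<le> S y"
  shows "S a * exp (- c * (b - a)) \<le> S b"
proof (rule tendsto_upperbound)
  show "(\<lambda>n. S a * (1 + (- c * (b - a)) / real n) ^ n) \<longlonglongrightarrow> S a * exp (- c * (b - a))"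
    by (intro tendsto_intros tendsto_exp_limit_sequentially)
  show "\<forall>\<^sub>F n in sequentially. S a * (1 + (- c * (b - a)) / real n) ^ n \<le> S b"
    \<comment> \<open>For \<open>n\<close> at least \<open>c * (b - a)\<close> every factor is non-negative, so the bounds can be multiplied.\<close>
  proof (rule eventually_mono[OF eventually_ge_at_top[of "Suc (nat \<lceil>c * (b - a)\<rceil>)"]])
    fix n assume n: "Suc (nat \<lceil>c * (b - a)\<rceil>) \<le> n"
    define q where "q = 1 + (- c * (b - a)) / real n"
    have n0: "0 < real n" using n by linarith
    have "c * (b - a) \<le> real n" using n by linarith
    then have q: "0 \<le> q" using n0 by (simp add: q_def field_simps)
    define h where "h = (b - a) / n"
    have h: "0 \<le> h" "n * h = b - a" "q = 1 - c * h"
      using \<open>a \<le> b\<close> n0 by (auto simp: h_def q_def)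
    have "S a * q ^ k \<le> S (a + k * h)" if "k \<le> n" for k
      using that
    proof (induction k)
      case 0
      then show ?case by simp
    next
      case (Suc k)
      have Suc_k: "Suc k * h = k * h + h" "0 \<le> k * h"
        using h by (simp_all add: distrib_right)
      have "Suc k * h \<le> n * h"
        using Suc.prems h by (intro mult_right_mono) auto
      then have le_b: "a + Suc k * h \<le> b" using h by simp
      have "S a * q ^ Suc k = (S a * q ^ k) * q" by simp
      also have "\<dots> \<le> S (a + k * h) * q"
        using Suc q by (intro mult_right_mono) auto
      also have "\<dots> = S (a + k * h) * (1 - c * ((a + Suc k * h) - (a + k * h)))"
        unfolding Suc_k(1) h(3) by simp
      also have "\<dots> \<le> S (a + Suc k * h)"
        using h Suc_k le_b by (intro step) linarith+
      finally show ?case .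
    qed
    from this[of n] show "S a * (1 + (- c * (b - a)) / real n) ^ n \<le> S b"
      using h by (simp add: q_def)
  qed
qed simp

text \<open>
  If the hazard \<open>f / S\<close> is non-increasing, the cumulative hazard \<open>- ln S\<close> grows over \<open>[a, b]\<close> by at
  most \<open>b - a\<close> times the hazard at \<open>a\<close>, and by at least \<open>b - a\<close> times the hazard at \<open>b\<close>. These
  are the two halves of concavity of \<open>- ln S\<close>, in exponentiated form. Since \<open>f\<close> is only a density
  and \<open>S\<close> need not be differentiable, they are obtained from increments of \<open>S\<close>: on a short interval
  \<open>f = (f / S) * S\<close> is bounded by the product of the extreme values of the two monotone factors.
  The open interval in the increment and the strict inequality \<open>t < b\<close> allow \<open>S b = 0\<close> in the
  first bound, which is how a zero of \<open>S\<close> will be excluded.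
\<close>

lemma DFR_survival_bounds:
  fixes S f :: "real \<Rightarrow> real"
  assumes int_f: "integrable lborel f"
    and inc: "\<And>x y. 0 \<le> x \<Longrightarrow> x \<le> y \<Longrightarrow> S x - S y = (LINT t:{x<..<y}|lborel. f t)"
    and dec: "\<And>x y. 0 \<le> x \<Longrightarrow> x \<le> y \<Longrightarrow> S y \<le> S x"
    and rate: "antimono_on {0<..} (\<lambda>t. f t / S t)"
    and rate0: "\<And>t. 0 \<le> f t / S t"
  shows "\<lbrakk>0 < a; a \<le> b; \<And>t. 0 \<le> t \<Longrightarrow> t < b \<Longrightarrow> 0 < S t\<rbrakk> \<Longrightarrow> S a * exp (- (f a / S a) * (b - a)) \<le> S b"
    and "\<lbrakk>0 \<le> a; a \<le> b; 0 < S b\<rbrakk> \<Longrightarrow> S b * exp (f b / S b * (b - a)) \<le> S a"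
proof -
  have f_int: "set_integrable lborel {x<..<y} f" for x y
    using int_f integrable_mult_indicator[of "{x<..<y}" lborel f] by (simp add: set_integrable_def)
  have c_int: "set_integrable lborel {x<..<y} (\<lambda>_. c::real)" for x y c :: real
    by (cases "x \<le> y") (auto simp: set_integrable_def integrable_indicator_iff)
  have c_val: "(LINT t:{x<..<y}|lborel. c) = c * (y - x)" if "x \<le> y" for x y c :: real
    using that by (simp add: set_lebesgue_integral_def)
  {
    assume a: "0 < a" "a \<le> b" and pos: "\<And>t. 0 \<le> t \<Longrightarrow> t < b \<Longrightarrow> 0 < S t"
    show "S a * exp (- (f a / S a) * (b - a)) \<le> S b"
    proof (rule exp_le_of_relative_increments)
      fix x y assume xy: "a \<le> x" "x \<le> y" "y \<le> b"
      have "S x - S y = (LINT t:{x<..<y}|lborel. f t)" using a xy by (intro inc) auto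
      also have "\<dots> \<le> (LINT t:{x<..<y}|lborel. f a / S a * S x)"
      proof (intro set_integral_mono f_int c_int)
        fix t assume t: "t \<in> {x<..<y}"
        have "f t = f t / S t * S t" using pos[of t] t xy a by simp
        also have "\<dots> \<le> f a / S a * S x"
          using t xy a pos[of t] rate0[of a]
          by (intro mult_mono monotone_onD[OF rate] dec) auto
        finally show "f t \<le> f a / S a * S x" .
      qed
      also have "\<dots> = f a / S a * S x * (y - x)" using xy by (intro c_val)
      finally show "S x * (1 - f a / S a * (y - x)) \<le> S y"
        by (simp add: algebra_simps)
    qed fact
  }
  {
    assume a: "0 \<le> a" "a \<le> b" and pos: "0 < S b"
    have "S (- (-b)) * exp (- (- (f b / S b)) * (-a - (-b))) \<le> S (- (-a))"
    proof (rule exp_le_of_relative_increments[where S="\<lambda>x. S (-x)"])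
      fix x y assume xy: "-b \<le> x" "x \<le> y" "y \<le> -a"
      have "f b / S b * S (-x) * (-x - (-y)) = (LINT t:{-y<..<-x}|lborel. f b / S b * S (-x))"
        using xy by (intro c_val[symmetric]) simp
      also have "\<dots> \<le> (LINT t:{-y<..<-x}|lborel. f t)"
      proof (intro set_integral_mono f_int c_int)
        fix t assume t: "t \<in> {-y<..<-x}"
        have St: "0 < S t" using dec[of t b] t xy a pos by auto
        have Sx: "0 < S (-x)" using dec[of "-x" b] t xy a pos by auto
        have "f b / S b * S (-x) \<le> f t / S t * S t"
          using t xy a St Sx rate0[of t]
          by (intro mult_mono monotone_onD[OF rate] dec) auto
        also have "\<dots> = f t" using St by simp
        finally show "f b / S b * S (-x) \<le> f t" .
      qed
      also have "\<dots> = S (-y) - S (-x)" using xy a by (intro inc[symmetric]) auto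
      finally show "S (-x) * (1 - - (f b / S b) * (y - x)) \<le> S (-y)"
        by (simp add: algebra_simps)
    qed (use a in simp)
    then show "S b * exp (f b / S b * (b - a)) \<le> S a" by simp
  }
qed

text \<open>
  Positivity: were there a first zero \<open>b\<close> of \<open>S\<close>, then the exponential lower bound starting from
  \<open>b / 2\<close> would make \<open>S b\<close> positive.

  The second claim says that \<open>- ln (S x) / x\<close> is non-increasing. With \<open>r\<close> the hazard at \<open>y\<close>,
  \<open>- ln S\<close> rises by at least \<open>r * y\<close> on \<open>[0, y]\<close> and by at most \<open>r * (x - y)\<close> on \<open>[y, x]\<close>,
  so its average slope cannot increase from \<open>[0, y]\<close> to \<open>[0, x]\<close>. This is all that the comparison
  with an exponential survival function needs.
\<close>

lemma DFR_survival_positive_and_star_shaped: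
  fixes S f :: "real \<Rightarrow> real"
  assumes int_f: "integrable lborel f"
    and inc: "\<And>x y. 0 \<le> x \<Longrightarrow> x \<le> y \<Longrightarrow> S x - S y = (LINT t:{x<..<y}|lborel. f t)"
    and dec: "\<And>x y. 0 \<le> x \<Longrightarrow> x \<le> y \<Longrightarrow> S y \<le> S x"
    and rate: "antimono_on {0<..} (\<lambda>t. f t / S t)"
    and rate0: "\<And>t. 0 \<le> f t / S t"
    and cont: "continuous_on UNIV S"
    and S0: "S 0 = 1" and nonneg: "\<And>x. 0 \<le> S x"
  shows "0 \<le> x \<Longrightarrow> 0 < S x"
    and "\<lbrakk>0 < y; y \<le> x\<rbrakk> \<Longrightarrow> x * ln (S y) \<le> y * ln (S x)"
proof -
  note lower = DFR_survival_bounds(1)[OF int_f inc dec rate rate0]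
  note upper = DFR_survival_bounds(2)[OF int_f inc dec rate rate0]
  have pos: "0 < S x" if "0 \<le> x" for x
  proof (rule ccontr)
    assume "\<not> 0 < S x"
    then have Sx: "S x = 0" using nonneg[of x] by simp
    define Z where "Z = {t. 0 \<le> t \<and> S t = 0}"
    define b where "b = Inf Z"
    have "closed Z" unfolding Z_def
      by (intro closed_Collect_conj closed_Collect_le closed_Collect_eq continuous_intros cont)
    moreover have "bdd_below Z" by (auto simp: Z_def bdd_below_def)
    moreover have "Z \<noteq> {}" using that Sx by (auto simp: Z_def)
    ultimately have b: "b \<in> Z" unfolding b_def by (intro closed_contains_Inf)
    have before: "0 < S t" if "0 \<le> t" "t < b" for t
    proof (rule ccontr)
      assume "\<not> 0 < S t"
      then have "t \<in> Z" using that nonneg[of t] by (simp add: Z_def)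
      then show False using that cInf_lower[OF _ \<open>bdd_below Z\<close>, of t] by (simp add: b_def)
    qed
    have b0: "0 < b" using b S0 by (cases "b = 0") (auto simp: Z_def)
    have "0 < S (b / 2) * exp (- (f (b / 2) / S (b / 2)) * (b - b / 2))"
      using before[of "b / 2"] b0 by simp
    also have "\<dots> \<le> S b" using b0 before by (intro lower) auto
    finally show False using b by (simp add: Z_def)
  qed
  then show "0 \<le> x \<Longrightarrow> 0 < S x" .
  assume xy: "0 < y" "y \<le> x"
  define r where "r = f y / S y"
  have Sy: "0 < S y" and Sx: "0 < S x" using pos xy by auto
  have "S y * exp (r * (y - 0)) \<le> S 0" unfolding r_def using xy Sy by (intro upper) auto
  then have "ln (S y * exp (r * y)) \<le> 0" using Sy S0 by simp
  then have 1: "ln (S y) + r * y \<le> 0" using Sy by (simp add: ln_mult)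
  have "S y * exp (- r * (x - y)) \<le> S x" unfolding r_def using xy pos by (intro lower) auto
  then have "ln (S y * exp (- r * (x - y))) \<le> ln (S x)" using Sy Sx by simp
  then have 2: "ln (S y) - r * (x - y) \<le> ln (S x)" using Sy by (simp add: ln_mult)
  have "x * ln (S y) = y * ln (S y) + (x - y) * ln (S y)" by (simp add: algebra_simps)
  also have "\<dots> \<le> y * ln (S y) - (x - y) * (r * y)"
    using 1 mult_left_mono[of "ln (S y)" "- (r * y)" "x - y"] xy by simp
  also have "\<dots> = y * (ln (S y) - r * (x - y))" by (simp add: algebra_simps)
  also have "\<dots> \<le> y * ln (S x)" using 2 xy by (intro mult_left_mono) auto
  finally show "x * ln (S y) \<le> y * ln (S x)" .
qed

section \<open>The integrand and its value for the exponential distribution\<close>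

text \<open>
  With \<open>s = 1 - F x\<close> this is the survival function plus \<open>F x * ln (F x)\<close>; its integral is the
  amount by which the cumulative entropy falls short of the mean.
\<close>

definition entropy_deficit :: "real \<Rightarrow> real" where
  "entropy_deficit s = s + (1 - s) * ln (1 - s)"

lemma borel_measurable_entropy_deficit [measurable]: "entropy_deficit \<in> borel_measurable borel"
  unfolding entropy_deficit_def by measurable

lemma entropy_deficit_le: "0 \<le> s \<Longrightarrow> s \<le> 1 \<Longrightarrow> entropy_deficit s \<le> s"
  using mult_nonneg_nonpos[of "1 - s" "ln (1 - s)"] ln_le_zero_iff[of "1 - s"]
  by (cases "s = 1") (auto simp: entropy_deficit_def)

text \<open>
  The tangent inequality of convexity at the point \<open>s\<close>, as \<open>- ln (1 - s)\<close> is the derivative of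
  \<open>entropy_deficit\<close> there. It amounts to \<open>ln t \<le> t - 1\<close> at \<open>t = (1 - s) / (1 - u)\<close>.
\<close>

lemma entropy_deficit_diff_le:
  assumes "s < 1" "u < 1"
  shows "entropy_deficit s - entropy_deficit u \<le> - ln (1 - s) * (s - u)"
proof -
  have "ln ((1 - s) / (1 - u)) \<le> (1 - s) / (1 - u) - 1"
    using assms by (intro ln_le_minus_one) simp
  then have "(1 - u) * ln ((1 - s) / (1 - u)) \<le> (1 - u) * ((1 - s) / (1 - u) - 1)"
    using assms by (intro mult_left_mono) auto
  also have "\<dots> = u - s" using assms by (simp add: field_simps)
  finally have "(1 - u) * (ln (1 - s) - ln (1 - u)) \<le> u - s"
    using assms by (simp add: ln_div)
  then show ?thesis by (simp add: entropy_deficit_def algebra_simps)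
qed

lemma entropy_deficit_nonneg: "0 \<le> s \<Longrightarrow> s < 1 \<Longrightarrow> 0 \<le> entropy_deficit s"
  using entropy_deficit_diff_le[of 0 s] by (simp add: entropy_deficit_def)

text \<open>
  The series of \<open>- ln (1 - s)\<close> enters twice, once without its first term and once multiplied by
  \<open>s\<close>. All coefficients of the result are non-negative, so it may be integrated termwise.
\<close>

lemma entropy_deficit_sums:
  assumes "0 \<le> s" "s < 1"
  shows "(\<lambda>n. s ^ (n + 2) / (real (n + 1) * real (n + 2))) sums entropy_deficit s"
proof -
  have "(\<lambda>n. - ((s ^ n) / real n)) sums ln (1 - s)"
    using ln_series'[of "-s"] assms by simp
  from sums_minus[OF this] have 0: "(\<lambda>n. s ^ n / real n) sums (- ln (1 - s))" by simp
  from sums_split_initial_segment[OF 0, of 1]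
  have 1: "(\<lambda>n. s ^ (n + 1) / real (n + 1)) sums (- ln (1 - s))" by simp
  from sums_split_initial_segment[OF 0, of 2]
  have 2: "(\<lambda>n. s ^ (n + 2) / real (n + 2)) sums (- ln (1 - s) - s)"
    by (simp add: numeral_2_eq_2)
  have "(\<lambda>n. s * (s ^ (n + 1) / real (n + 1)) - s ^ (n + 2) / real (n + 2))
      sums (s * (- ln (1 - s)) - (- ln (1 - s) - s))"
    by (intro sums_diff sums_mult 1 2)
  also have "(\<lambda>n. s * (s ^ (n + 1) / real (n + 1)) - s ^ (n + 2) / real (n + 2))
      = (\<lambda>n. s ^ (n + 2) / (real (n + 1) * real (n + 2)))"
    by (auto simp: field_simps power2_eq_square)
  also have "s * (- ln (1 - s)) - (- ln (1 - s) - s) = entropy_deficit s"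
    by (simp add: entropy_deficit_def algebra_simps)
  finally show ?thesis .
qed

text \<open>
  Partial fractions, with \<open>m = n + 1\<close>: \<open>1 / (m * (m + 1)\<^sup>2)\<close> equals
  \<open>1 / m - 1 / (m + 1) - 1 / (m + 1)\<^sup>2\<close>, a telescoping part of sum \<open>1\<close> minus the Basel series
  without its first term.
\<close>

lemma sums_two_minus_Basel:
  "(\<lambda>n. 1 / (real (n + 1) * (real (n + 2))\<^sup>2)) sums (2 - pi\<^sup>2 / 6)"
proof -
  have "(\<lambda>n. 1 / real (n + 1) - 1 / real (Suc n + 1)) sums (1 / real (0 + 1) - 0)"
    by (rule telescope_sums') (use LIMSEQ_inverse_real_of_nat in \<open>simp add: inverse_eq_divide\<close>)
  moreover have "(\<lambda>n. 1 / (real (n + 2))\<^sup>2) sums (pi\<^sup>2 / 6 - 1)"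
    using sums_split_initial_segment[OF inverse_squares_sums, of 1] by (simp add: add.commute)
  ultimately have "(\<lambda>n. (1 / real (n + 1) - 1 / real (Suc n + 1)) - 1 / (real (n + 2))\<^sup>2)
      sums ((1 / real (0 + 1) - 0) - (pi\<^sup>2 / 6 - 1))"
    by (rule sums_diff)
  also have "(\<lambda>n. (1 / real (n + 1) - 1 / real (Suc n + 1)) - 1 / (real (n + 2))\<^sup>2)
      = (\<lambda>n. 1 / (real (n + 1) * (real (n + 2))\<^sup>2))"
  proof
    fix n :: nat
    define m where "m = real n + 1"
    have "m > 0" by (simp add: m_def)
    then have "1 / m - 1 / (m + 1) - 1 / (m + 1)\<^sup>2 = 1 / (m * (m + 1)\<^sup>2)"
      by (simp add: divide_simps power2_eq_square)
    then show "(1 / real (n + 1) - 1 / real (Suc n + 1)) - 1 / (real (n + 2))\<^sup>2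
        = 1 / (real (n + 1) * (real (n + 2))\<^sup>2)"
      by (simp add: m_def add.commute)
  qed
  finally show ?thesis by simp
qed

lemma nn_integral_exp_decay:
  assumes "0 < c"
  shows "(\<integral>\<^sup>+x. ennreal (exp (- (c * x))) * indicator {0..} x \<partial>lborel) = ennreal (1 / c)"
proof -
  have "(\<integral>\<^sup>+x. ennreal (exp (- (c * x))) * indicator {0..} x \<partial>lborel)
      = ennreal (0 - (- exp (- (c * 0)) / c))"
  proof (rule nn_integral_FTC_atLeast)
    show "((\<lambda>x. - exp (- (c * x)) / c) \<longlongrightarrow> 0) at_top" using assms by real_asymp
  qed (use assms in \<open>auto intro!: derivative_eq_intros\<close>)
  then show ?thesis by simp
qed

lemma exp_first_moment:
  fixes A :: real
  assumes "0 < A"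
  shows "set_integrable lborel {0..} (\<lambda>x. x * exp (- x / A))"
    and "(LINT x:{0..}|lborel. x * exp (- x / A)) = A\<^sup>2"
proof -
  have "(\<integral>\<^sup>+x. ennreal (x * exp (- x / A)) * indicator {0..} x \<partial>lborel)
      = ennreal (0 - (- (A * 0 + A\<^sup>2) * exp (- 0 / A)))"
  proof (rule nn_integral_FTC_atLeast)
    show "((\<lambda>x. - (A * x + A\<^sup>2) * exp (- x / A)) \<longlongrightarrow> 0) at_top" using assms by real_asymp
  next
    fix x :: real
    show "DERIV (\<lambda>x. - (A * x + A\<^sup>2) * exp (- x / A)) x :> x * exp (- x / A)"
      using assms by (auto intro!: derivative_eq_intros simp: field_simps power2_eq_square)
  qed auto
  then have "(\<integral>\<^sup>+x. ennreal (indicator {0..} x * (x * exp (- x / A))) \<partial>lborel) = ennreal (A\<^sup>2)"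
    by (simp add: indicator_mult_ennreal mult.commute)
  then have "integrable lborel (\<lambda>x. indicator {0..} x * (x * exp (- x / A)))
      \<and> (LINT x|lborel. indicator {0..} x * (x * exp (- x / A))) = A\<^sup>2"
    by (subst nn_integral_eq_integrable[symmetric]) (auto split: split_indicator)
  then show "set_integrable lborel {0..} (\<lambda>x. x * exp (- x / A))"
    and "(LINT x:{0..}|lborel. x * exp (- x / A)) = A\<^sup>2"
    by (auto simp: set_integrable_def set_lebesgue_integral_def)
qed

text \<open>
  The exponential distribution with mean \<open>A\<close> is the extremal case: here the power series of
  \<open>entropy_deficit\<close> is integrated term by term, and the integrals \<open>A / (n + 2)\<close> of the powers
  turn its coefficients into the series summed above.
\<close>

lemma entropy_deficit_exp:
  fixes A :: real
  assumes "0 < A"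
  shows "set_integrable lborel {0..} (\<lambda>x. entropy_deficit (exp (- x / A)))"
    and "(LINT x:{0..}|lborel. entropy_deficit (exp (- x / A))) = A * (2 - pi\<^sup>2 / 6)"
proof -
  define t where "t n x = 1 / (real (n + 1) * real (n + 2)) * exp (- (real (n + 2) / A * x))" for n x
  have t0: "0 \<le> t n x" for n x by (simp add: t_def)
  have t_sums: "(\<lambda>n. t n x) sums entropy_deficit (exp (- x / A))" if "0 < x" for x
  proof -
    have "(\<lambda>n. exp (- x / A) ^ (n + 2) / (real (n + 1) * real (n + 2)))
        sums entropy_deficit (exp (- x / A))"
      using that assms by (intro entropy_deficit_sums) auto
    also have "(\<lambda>n. exp (- x / A) ^ (n + 2) / (real (n + 1) * real (n + 2))) = (\<lambda>n. t n x)"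
    proof
      fix n
      have "exp (- x / A) ^ (n + 2) = exp (real (n + 2) * (- x / A))"
        by (rule exp_of_nat_mult[symmetric])
      then show "exp (- x / A) ^ (n + 2) / (real (n + 1) * real (n + 2)) = t n x"
        by (simp add: t_def)
    qed
    finally show ?thesis .
  qed
  have t_int: "(\<integral>\<^sup>+x. ennreal (t n x) * indicator {0..} x \<partial>lborel)
      = ennreal (A * (1 / (real (n + 1) * (real (n + 2))\<^sup>2)))" for n
  proof -
    have "(\<integral>\<^sup>+x. ennreal (t n x) * indicator {0..} x \<partial>lborel)
        = (\<integral>\<^sup>+x. ennreal (1 / (real (n + 1) * real (n + 2)))
            * (ennreal (exp (- (real (n + 2) / A * x))) * indicator {0..} x) \<partial>lborel)"
      unfolding t_def by (subst ennreal_mult) (simp_all add: mult.assoc)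
    also have "\<dots> = ennreal (1 / (real (n + 1) * real (n + 2))) * ennreal (1 / (real (n + 2) / A))"
      using assms by (subst nn_integral_cmult, simp, subst nn_integral_exp_decay) auto
    also have "\<dots> = ennreal (A * (1 / (real (n + 1) * (real (n + 2))\<^sup>2)))"
      using assms by (subst ennreal_mult[symmetric]) (auto simp: power2_eq_square)
    finally show ?thesis .
  qed
  have "(\<integral>\<^sup>+x. ennreal (indicator {0..} x * entropy_deficit (exp (- x / A))) \<partial>lborel)
      = (\<integral>\<^sup>+x. (\<Sum>n. ennreal (t n x) * indicator {0..} x) \<partial>lborel)"
  proof (rule nn_integral_cong_AE, use AE_lborel_singleton[of 0] in eventually_elim)
    fix x :: real assume "x \<noteq> 0"
    then show "ennreal (indicator {0..} x * entropy_deficit (exp (- x / A)))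
        = (\<Sum>n. ennreal (t n x) * indicator {0..} x)"
      using t_sums[of x] suminf_ennreal2[OF t0[of _ x]]
      by (auto simp: sums_iff split: split_indicator)
  qed
  also have "\<dots> = (\<Sum>n. \<integral>\<^sup>+x. ennreal (t n x) * indicator {0..} x \<partial>lborel)"
    unfolding t_def by (rule nn_integral_suminf) measurable
  also have "\<dots> = ennreal (A * (2 - pi\<^sup>2 / 6))"
    unfolding t_int using sums_mult[OF sums_two_minus_Basel, of A] assms
    by (subst suminf_ennreal2) (auto simp: sums_iff simp del: of_nat_add)
  finally have *: "(\<integral>\<^sup>+x. ennreal (indicator {0..} x * entropy_deficit (exp (- x / A))) \<partial>lborel)
      = ennreal (A * (2 - pi\<^sup>2 / 6))" .
  have "0 \<le> 2 - pi\<^sup>2 / 6"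
    using sums_le[OF _ sums_zero sums_two_minus_Basel] by simp
  moreover have "AE x in lborel. 0 \<le> indicator {0..} x * entropy_deficit (exp (- x / A))"
    using AE_lborel_singleton[of 0]
    by eventually_elim (use assms in \<open>auto intro!: entropy_deficit_nonneg split: split_indicator\<close>)
  ultimately have "integrable lborel (\<lambda>x. indicator {0..} x * entropy_deficit (exp (- x / A)))
      \<and> (LINT x|lborel. indicator {0..} x * entropy_deficit (exp (- x / A))) = A * (2 - pi\<^sup>2 / 6)"
    using * assms by (subst nn_integral_eq_integrable[symmetric]) auto
  then show "set_integrable lborel {0..} (\<lambda>x. entropy_deficit (exp (- x / A)))"
    and "(LINT x:{0..}|lborel. entropy_deficit (exp (- x / A))) = A * (2 - pi\<^sup>2 / 6)"
    by (auto simp: set_integrable_def set_lebesgue_integral_def)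
qed

section \<open>Comparison with the exponential distribution\<close>

text \<open>
  Let \<open>E x = exp (- x / A)\<close> with \<open>A\<close> chosen such that \<open>x * S x\<close> and \<open>x * E x\<close> have the same
  integral. The continuous functions \<open>S\<close> and \<open>E\<close> must then meet at some \<open>z > 0\<close>, and because the
  average slope \<open>- ln (S x) / x\<close> is non-increasing while that of \<open>E\<close> is constant, \<open>S \<le> E\<close> before
  \<open>z\<close> and \<open>S \<ge> E\<close> after \<open>z\<close>. By convexity the integrand difference is at most
  \<open>- ln (1 - S x) * (S x - E x)\<close>. The weight \<open>- ln (1 - S x) / x\<close> is non-increasing, so replacing
  it by its value \<open>c\<close> at \<open>z\<close> only increases this bound, on either side of \<open>z\<close>. The result
  \<open>c * (x * S x - x * E x)\<close> integrates to zero by the choice of \<open>A\<close>.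
\<close>

lemma entropy_deficit_integral_le_exponential:
  fixes S :: "real \<Rightarrow> real"
  assumes cont: "continuous_on UNIV S"
    and dec: "\<And>x y. 0 \<le> x \<Longrightarrow> x \<le> y \<Longrightarrow> S y \<le> S x"
    and pos: "\<And>x. 0 \<le> x \<Longrightarrow> 0 < S x"
    and star: "\<And>x y. 0 < y \<Longrightarrow> y \<le> x \<Longrightarrow> x * ln (S y) \<le> y * ln (S x)"
    and int: "set_integrable lborel {0..} S"
    and int1: "set_integrable lborel {0..} (\<lambda>x. x * S x)"
  shows "set_integrable lborel {0..} (\<lambda>x. entropy_deficit (S x))"
    and "(LINT x:{0..}|lborel. entropy_deficit (S x))
      \<le> sqrt (LINT x:{0..}|lborel. x * S x) * (2 - pi\<^sup>2 / 6)"
proof -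
  \<comment> \<open>A function of constant strict sign on \<open>x > 0\<close> cannot have integral zero: the next two facts
    give this both for \<open>x * S x\<close> and for its difference from \<open>x * E x\<close>.\<close>
  have AE_zero: "AE x in lborel. indicator {0..} x * g x = 0"
    if "set_integrable lborel {0..} g" "\<And>x. 0 \<le> x \<Longrightarrow> 0 \<le> g x" "(LINT x:{0..}|lborel. g x) = 0"
    for g :: "real \<Rightarrow> real"
  proof -
    have "AE x in lborel. 0 \<le> indicator {0..} x * g x"
      using that(2) by (auto split: split_indicator)
    then show ?thesis
      using that(1,3) integral_nonneg_eq_0_iff_AE[of lborel "\<lambda>x. indicator {0..} x * g x"]
      by (auto simp: set_integrable_def set_lebesgue_integral_def)
  qed
  have not_AE_zero: False if "AE x in lborel. indicator {0..} x * g x = 0" "\<And>x. 0 < x \<Longrightarrow> g x \<noteq> 0"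
    for g :: "real \<Rightarrow> real"
  proof -
    have "AE x in lborel. x \<notin> {0<..<1::real}"
      using that(1) by eventually_elim (use that(2) in \<open>force split: split_indicator_asm\<close>)
    then have "{0<..<1::real} \<in> null_sets lborel" by (simp add: AE_iff_null_sets)
    then show False by (simp add: null_sets_def)
  qed
  have meas [measurable]: "S \<in> borel_measurable borel"
    using cont by (rule borel_measurable_continuous_onI)
  define A where "A = sqrt (LINT x:{0..}|lborel. x * S x)"
  define E where "E x = exp (- x / A)" for x
  have xS0: "0 \<le> x * S x" if "0 \<le> x" for x using pos[OF that] that by simp
  have xS_ne: "x * S x \<noteq> 0" if "0 < x" for x using pos[of x] that by simp
  have I0: "0 \<le> (LINT x:{0..}|lborel. x * S x)"
    unfolding set_lebesgue_integral_def using xS0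
    by (intro integral_nonneg_AE) (auto split: split_indicator)
  moreover have "(LINT x:{0..}|lborel. x * S x) \<noteq> 0"
  proof
    assume "(LINT x:{0..}|lborel. x * S x) = 0"
    with AE_zero[OF int1 xS0] have "AE x in lborel. indicator {0..} x * (x * S x) = 0" by simp
    then show False using xS_ne by (rule not_AE_zero)
  qed
  ultimately have A: "0 < A" and A2: "A\<^sup>2 = (LINT x:{0..}|lborel. x * S x)"
    by (auto simp: A_def)
  note E_int1 = exp_first_moment(1)[OF A, folded E_def]
  have E_val: "(LINT x:{0..}|lborel. x * E x) = (LINT x:{0..}|lborel. x * S x)"
    using exp_first_moment(2)[OF A] A2 by (simp add: E_def)
  have E_cont: "continuous_on X E" for X
    unfolding E_def using A by (intro continuous_intros) auto
  have "\<exists>z>0. S z = E z"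
  proof (rule ccontr)
    assume no: "\<not> (\<exists>z>0. S z = E z)"
    have diff0: "(LINT x:{0..}|lborel. x * S x - x * E x) = 0"
      "(LINT x:{0..}|lborel. x * E x - x * S x) = 0"
      using E_val by (simp_all add: set_integral_diff int1 E_int1)
    have "(\<forall>x>0. S x < E x) \<or> (\<forall>x>0. E x < S x)"
    proof (rule ccontr)
      assume "\<not> ?thesis"
      then obtain x y where xy: "0 < x" "0 < y" "S x > E x" "S y < E y"
        using no by (meson linorder_neqE_linordered_idom)
      have "connected ((\<lambda>t. S t - E t) ` {0<..})"
        by (intro connected_continuous_image continuous_intros E_cont
            continuous_on_subset[OF cont]) auto
      then have "0 \<in> (\<lambda>t. S t - E t) ` {0<..}"
        by (rule connectedD_interval[of _ "S y - E y" "S x - E x"]) (use xy in auto)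
      then show False using no by auto
    qed
    moreover have "x * E x - x * S x \<noteq> 0" "x * S x - x * E x \<noteq> 0" if "0 < x" for x
      using no that by auto
    note diff_ne = this
    ultimately show False
    proof (elim disjE)
      assume lt: "\<forall>x>0. S x < E x"
      have "0 \<le> x * E x - x * S x" if "0 \<le> x" for x
        using lt that by (cases "x = 0") (auto simp: mult_left_mono less_imp_le)
      with AE_zero[OF set_integral_diff(1)[OF E_int1 int1] _ diff0(2)]
      have "AE x in lborel. indicator {0..} x * (x * E x - x * S x) = 0" by simp
      then show False using diff_ne(1) by (rule not_AE_zero)
    next
      assume lt: "\<forall>x>0. E x < S x"
      have "0 \<le> x * S x - x * E x" if "0 \<le> x" for x
        using lt that by (cases "x = 0") (auto simp: mult_left_mono less_imp_le)
      with AE_zero[OF set_integral_diff(1)[OF int1 E_int1] _ diff0(1)]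
      have "AE x in lborel. indicator {0..} x * (x * S x - x * E x) = 0" by simp
      then show False using diff_ne(2) by (rule not_AE_zero)
    qed
  qed
  then obtain z where z: "0 < z" "S z = E z" by blast
  have ln_z: "ln (S z) = - z / A" by (simp add: z E_def)
  have before: "S x \<le> E x" if "0 < x" "x \<le> z" for x
  proof -
    have "z * ln (S x) \<le> x * ln (S z)" by (rule star[OF that])
    also have "\<dots> = z * (- x / A)" unfolding ln_z by simp
    finally have "ln (S x) \<le> - x / A" using z(1) by (rule mult_left_le_imp_le)
    then show ?thesis unfolding E_def using pos[of x] that by (metis exp_le_cancel_iff exp_ln less_imp_le)
  qed
  have after: "E x \<le> S x" if "z \<le> x" for x
  proof -
    have "z * (- x / A) = x * ln (S z)" unfolding ln_z by simp
    also have "\<dots> \<le> z * ln (S x)" by (rule star[OF z(1) that])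
    finally have "- x / A \<le> ln (S x)" using z(1) by (rule mult_left_le_imp_le)
    then show ?thesis unfolding E_def using pos[of x] z that by (simp add: ln_ge_iff)
  qed
  have E_lt: "E x < 1" if "0 < x" for x using that A by (simp add: E_def)
  \<comment> \<open>Up to \<open>z\<close> this comes from \<open>S \<le> E\<close>, beyond \<open>z\<close> from monotonicity. At 1 the tangent
    inequality would break down.\<close>
  have S_lt: "S x < 1" if "0 < x" for x
    using before[of "min x z"] E_lt[of "min x z"] dec[of "min x z" x] that z by linarith
  define c where "c = - ln (1 - S z) / z"
  have key: "entropy_deficit (S x) - entropy_deficit (E x) \<le> c * (x * S x - x * E x)" if "0 < x" for x
  proof -
    define w where "w = - ln (1 - S x)"
    have wz0: "0 \<le> - ln (1 - S z)" using S_lt[OF z(1)] pos[of z] z by simp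
    have "entropy_deficit (S x) - entropy_deficit (E x) \<le> w * (S x - E x)"
      unfolding w_def by (intro entropy_deficit_diff_le S_lt E_lt that)
    also have "\<dots> \<le> (c * x) * (S x - E x)"
    proof (cases "x \<le> z")
      case True
      have "c * x = - ln (1 - S z) * (x / z)" by (simp add: c_def)
      also have "\<dots> \<le> - ln (1 - S z) * 1" using wz0 z True by (intro mult_left_mono) auto
      also have "\<dots> \<le> w" unfolding w_def using S_lt[OF that] S_lt[OF z(1)] dec[of x z] that True by simp
      finally show ?thesis using before[OF that True] by (intro mult_right_mono_neg) auto
    next
      case False
      have "w \<le> - ln (1 - S z) * 1" unfolding w_def
        using S_lt[OF that] S_lt[OF z(1)] dec[of z x] z False by simp
      also have "\<dots> \<le> - ln (1 - S z) * (x / z)" using wz0 z False by (intro mult_left_mono) auto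
      also have "\<dots> = c * x" by (simp add: c_def)
      finally show ?thesis using after[of x] False by (intro mult_right_mono) auto
    qed
    finally show ?thesis by (simp add: algebra_simps)
  qed
  \<comment> \<open>The single point \<open>0\<close>, where \<open>S\<close> may equal 1, is discarded as a null set.\<close>
  show h_int: "set_integrable lborel {0..} (\<lambda>x. entropy_deficit (S x))"
  proof -
    have "AE x in lborel. norm (indicator {0..} x *\<^sub>R entropy_deficit (S x))
        \<le> norm (indicator {0..} x *\<^sub>R S x)"
      using AE_lborel_singleton[of 0]
    proof eventually_elim
      case (elim x)
      then show ?case
        using entropy_deficit_le[of "S x"] entropy_deficit_nonneg[of "S x"] S_lt[of x] pos[of x]
        by (auto split: split_indicator)
    qed
    then show ?thesis unfolding set_integrable_def
      by (rule Bochner_Integration.integrable_bound[OF int[unfolded set_integrable_def], rotated]) simp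
  qed
  note hE_int = entropy_deficit_exp(1)[OF A, folded E_def]
  have "(LINT x:{0..}|lborel. entropy_deficit (S x) - entropy_deficit (E x))
      \<le> (LINT x:{0..}|lborel. c * (x * S x - x * E x))"
  proof (rule set_integral_mono_AE)
    show "AE x\<in>{0..} in lborel. entropy_deficit (S x) - entropy_deficit (E x)
        \<le> c * (x * S x - x * E x)"
      using AE_lborel_singleton[of 0] by eventually_elim (use key in auto)
  qed (auto intro!: set_integral_diff(1) set_integrable_mult_right h_int hE_int int1 E_int1)
  also have "\<dots> = 0" using E_val by (simp add: set_integral_diff int1 E_int1)
  finally show "(LINT x:{0..}|lborel. entropy_deficit (S x))
      \<le> sqrt (LINT x:{0..}|lborel. x * S x) * (2 - pi\<^sup>2 / 6)"
    using entropy_deficit_exp(2)[OF A, folded E_def]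
    by (simp add: set_integral_diff h_int hE_int A_def[symmetric])
qed

section \<open>The entropy bound\<close>

theorem theorem2:
  fixes M :: "'a measure" and X :: "'a \<Rightarrow> real"
  assumes "prob_space M"
    and "X \<in> borel_measurable M"
    and "AE \<omega> in M. 0 \<le> X \<omega>"
    and "absolutely_continuous lborel (distr M borel X)"
    and "integrable M (\<lambda>\<omega>. (X \<omega>)\<^sup>2)"
    and "DFR M X"
  shows "cumulative_entropy M X \<ge>
    (LINT \<omega>|M. X \<omega>) - sqrt (LINT \<omega>|M. (X \<omega>)\<^sup>2) / sqrt 2 * (2 - pi\<^sup>2 / 6)"
proof -
  interpret prob_space M by fact
  note X_meas [measurable] = assms(2)
  interpret D: real_distribution "distr M borel X" by simp
  define S where "S x = 1 - cdf (distr M borel X) x" for x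
  obtain f where f0: "\<And>x. 0 \<le> f x" and dist: "distributed M lborel X (\<lambda>x. ennreal (f x))"
    and "antimono_on {0<..} (failure_rate M X f)"
    using assms(6) by (auto simp: DFR_def)
  then have rate: "antimono_on {0<..} (\<lambda>t. f t / S t)"
    by (simp add: failure_rate_def[abs_def] S_def)
  have int_f: "integrable lborel f"
    using distributed_integrable[OF dist, of "\<lambda>_. 1"] f0 by simp
  have point_null: "{x} \<in> null_sets (distr M borel X)" for x
    using assms(4) finite_imp_null_set_lborel[of "{x}"] by (auto simp: absolutely_continuous_def)
  have S_nonneg: "0 \<le> S x" for x
    using D.cdf_bounded_prob[of x] by (simp add: S_def)
  have S_dec: "S y \<le> S x" if "x \<le> y" for x y
    using D.cdf_nondecreasing[OF that] by (simp add: S_def)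
  have "isCont (cdf (distr M borel X)) x" for x
    using point_null[of x] by (simp add: D.isCont_cdf measure_def null_setsD1)
  then have S_cont: "continuous_on UNIV S"
    unfolding S_def by (intro continuous_intros) (simp add: continuous_on_eq_continuous_at)
  \<comment> \<open>The distribution has no atoms, so the right end point of \<open>{x<..y}\<close> can be dropped.\<close>
  have S_diff: "S x - S y = (LINT t:{x<..<y}|lborel. f t)" if "x \<le> y" for x y
  proof (cases "x = y")
    case True
    then show ?thesis by (simp add: set_lebesgue_integral_def)
  next
    case False
    then have "x < y" using that by simp
    then have "S x - S y = measure (distr M borel X) ({x<..<y} \<union> {y})"
      unfolding ivl_disj_un_singleton(4)[OF \<open>x < y\<close>] by (simp add: S_def D.cdf_diff_eq)
    also have "\<dots> = measure (distr M borel X) {x<..<y}"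
      by (intro measure_Un_null_set point_null) simp
    also have "\<dots> = (LINT \<omega>|M. indicator {x<..<y} (X \<omega>))"
      by (subst integral_distr[symmetric, where N=borel and f="indicator {x<..<y}"]) auto
    also have "\<dots> = (LINT t|lborel. f t * indicator {x<..<y} t)"
      using f0 by (intro distributed_integral[OF dist, symmetric]) auto
    finally show ?thesis by (simp add: set_lebesgue_integral_def mult.commute)
  qed
  have "AE x in distr M borel X. x \<notin> {..0}"
  proof -
    have "AE x in distr M borel X. 0 \<le> x"
      using assms(3) by (subst AE_distr_iff) auto
    moreover have "AE x in distr M borel X. x \<notin> {0}"
      using point_null[of 0] by (rule AE_not_in)
    ultimately show ?thesis by eventually_elim auto
  qed
  then have "{..0} \<in> null_sets (distr M borel X)" by (simp add: AE_iff_null_sets)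
  then have S_0: "S 0 = 1" by (simp add: S_def cdf_def2 measure_def null_setsD1)
  note DFR_survival = DFR_survival_positive_and_star_shaped[of f S,
      OF int_f S_diff S_dec rate _ S_cont S_0 S_nonneg]
  have S_pos: "0 < S x" if "0 \<le> x" for x
    using that f0 S_nonneg by (intro DFR_survival(1)) auto
  have S_star: "x * ln (S y) \<le> y * ln (S x)" if "0 < y" "y \<le> x" for x y
    using that f0 S_nonneg by (intro DFR_survival(2)) auto
  have int_X: "integrable M X"
    using assms(5) by (rule square_integrable_imp_integrable[OF X_meas])
  have S_int: "set_integrable lborel {0..} S"
    and mean: "(LINT x:{0..}|lborel. S x) = expectation X"
    using moment_eq_tail_integral[of X 0] assms(3) int_X by (simp_all add: S_def[abs_def])
  have "integrable M (\<lambda>\<omega>. X \<omega> ^ Suc 1)" using assms(5) by (simp add: power2_eq_square)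
  note second_moment = moment_eq_tail_integral[OF X_meas assms(3) this, folded S_def]
  have S_int1: "set_integrable lborel {0..} (\<lambda>x. x * S x)"
    using second_moment(1) by (simp add: mult.assoc)
  have second: "2 * (LINT x:{0..}|lborel. x * S x) = expectation (\<lambda>\<omega>. (X \<omega>)\<^sup>2)"
    using second_moment(2) by (simp add: mult.assoc power2_eq_square)
  note deficit = entropy_deficit_integral_le_exponential[OF S_cont S_dec S_pos S_star S_int S_int1]
  have h_int: "set_integrable lborel {0..} (\<lambda>x. entropy_deficit (S x))"
    by (rule deficit)
  have h_le: "(LINT x:{0..}|lborel. entropy_deficit (S x))
      \<le> sqrt (LINT x:{0..}|lborel. x * S x) * (2 - pi\<^sup>2 / 6)"
    by (rule deficit)
  have "cumulative_entropy M X
      = - (LINT x:{0..}|lborel. entropy_deficit (S x) - S x)"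
    by (simp add: cumulative_entropy_def entropy_deficit_def S_def)
  also have "\<dots> = expectation X - (LINT x:{0..}|lborel. entropy_deficit (S x))"
    by (simp add: set_integral_diff h_int S_int mean)
  also have "\<dots> \<ge> expectation X - sqrt (LINT x:{0..}|lborel. x * S x) * (2 - pi\<^sup>2 / 6)"
    using h_le by simp
  also have "sqrt (LINT x:{0..}|lborel. x * S x) = sqrt (expectation (\<lambda>\<omega>. (X \<omega>)\<^sup>2)) / sqrt 2"
    by (simp add: second[symmetric] real_sqrt_mult)
  finally show ?thesis .
qed

end
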